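(* The following rules of inference of fuzzy geometric logic are universally valid (sound): for every interpretation $I$, whenever all premises of (an instance of) a rule are valid in $I$, the conclusion is valid in $I$ (in particular, rules without premises are valid in every interpretation). Here $\phi,\psi,\chi$ are geometric formulae, $S$ is a set of geometric formulae, and $x,y,x_i,y_i$ are variables. 1. $\phi\vdash\phi$. 2. From $\phi\vdash\psi$ and $\psi\vdash\chi$ infer $\phi\vdash\chi$. 3. (i) $\phi\vdash\top$; (ii) $\phi\wedge\psi\vdash\phi$; (iii) $\phi\wedge\psi\vdash\psi$; (iv) from $\phi\vdash\psi$ and $\phi\vdash\chi$ infer $\phi\vdash\psi\wedge\chi$. 4. (i) $\phi\vdash\bigvee S$ for $\phi\in S$; (ii) from $\phi\vdash\psi$ for all $\phi\in S$ infer $\bigvee S\vdash\psi$. 5. $\phi\wedge\bigvee S\vdash\bigvee\{\phi\wedge\psi\mid\psi\in S\}$. 6. $\top\vdash(x=x)$. 7. $((x_1,\dots,x_n)=(y_1,\dots,y_n))\wedge\phi\vdash\phi[(y_1,\dots,y_n)/(x_1,\dots,x_n)]$. 8. (i) From $\phi\vdash\psi[x/y]$ infer $\phi\vdash\exists y\psi$; (ii) from $\exists y\phi\vdash\psi$ infer $\phi[x/y]\vdash\psi$. 9. $\phi\wedge(\exists y)\psi\vdash(\exists y)(\phi\wedge\psi)$.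
   Context: Language: countably many individual constants $c_i$, denumerably many variables $x_1,x_2,\dots$, propositional constants $\top,\bot$, for each $i>0$ countably many $i$-place predicate symbols $p^i_j$ (including 2-place identity "$=$") and countably many $i$-place function symbols $f^i_j$. Terms are built from constants and variables by function symbols. Geometric formulae: $\top$, $\bot$, $p^i_jt_1\dots t_i$, $(t_i=t_j)$ for terms; $(\phi\wedge\psi)$; $\bigvee\{\phi_i\}_{i\in I}$ for any family of geometric formulae (for a two-element index set written $\phi_1\vee\phi_2$); $\exists x_i\phi$; nothing else. $(x_1,\dots,x_n)=(y_1,\dots,y_n)$ means the conjunction of the equations $x_i=y_i$. $\phi[t/x]$ is the result of replacing every free occurrence of $x$ in $\phi$ by the term $t$ (simultaneously for tuples), defined recursively: it replaces $x$ by $t$ in the terms of atomic formulae, commutes with $\wedge$ and $\bigvee$, fixes $\top$ and $\bot$, $(\exists x_i\psi)[t/x]=\exists x_i(\psi[t/x])$ if $x_i$ is other than $x$, and $(\exists x\psi)[t/x]=\exists x\psi$. An interpretation $I$ consists of a set $D$, elements $I(c_i)\in D$, functions $I(f^i_j):D^i\to D$ and fuzzy relations $I(p^i_j):D^i\to[0,1]$. For a sequence $s=(s_1,s_2,\dots)$ over $D$ and $d\in D$, $s(d/x_i)$ is $s$ with its $i$-th coordinate replaced by $d$; $s(c_i)=I(c_i)$, $s(x_i)=s_i$, $s(f^i_jt_1\dots t_i)=I(f^i_j)(s(t_1),\dots,s(t_i))$. The grade of satisfaction $gr(s\ \text{sat}\ \phi)\in[0,1]$ is: $gr(s\ \text{sat}\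 p^i_jt_1\dots t_i)=I(p^i_j)(s(t_1),\dots,s(t_i))$; $gr(s\ \text{sat}\ \top)=1$; $gr(s\ \text{sat}\ \bot)=0$; $gr(s\ \text{sat}\ t_i=t_j)=1$ if $s(t_i)=s(t_j)$ and $0$ otherwise; $gr(s\ \text{sat}\ \phi_1\wedge\phi_2)=\min$ of the two grades; $gr(s\ \text{sat}\ \bigvee\{\phi_i\}_{i\in I})=\sup_{i}gr(s\ \text{sat}\ \phi_i)$; $gr(s\ \text{sat}\ \exists x_i\phi)=\sup_{d\in D}gr(s(d/x_i)\ \text{sat}\ \phi)$. A sequent is an expression $\phi\vdash\psi$. It is valid in $I$ if $gr(s\ \text{sat}\ \phi)\le gr(s\ \text{sat}\ \psi)$ for all sequences $s$ over the domain of $I$.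
   Formalization: Standard provisos are added, without which the rules fail: in rule 7 the y_i must be free for the x_i in φ; in rule 8 x must be free for y in the formula substituted into (ψ in (i), φ in (ii)); in rule 9 y must not be free in φ. *)

theory Defs
  imports Complex_Main
begin

section \<open>Grades\<close>

text \<open>
  Grades live in the complete chain [0,1]. Suprema are taken in this lattice, so the supremum
  of the empty set is 0 (unlike \<open>real\<close>, where it is unspecified).
\<close>

typedef grade = "{0..1::real}"
  morphisms real_of_grade Grade
  by (rule exI[of _ 0]) simp

lemma real_of_grade_bounds: "0 \<le> real_of_grade a" "real_of_grade a \<le> 1"
  using real_of_grade[of a] by auto

lemma bdd_real_of_grade: "bdd_above (real_of_grade ` A)" "bdd_below (real_of_grade ` A)"
  using real_of_grade_bounds by (auto intro!: bdd_aboveI[of _ 1] bdd_belowI[of _ 0])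

instantiation grade :: "{zero_neq_one, complete_linorder}"
begin

definition "0 = Grade 0"
definition "1 = Grade 1"
definition "a \<le> b \<longleftrightarrow> real_of_grade a \<le> real_of_grade b"
definition "a < b \<longleftrightarrow> real_of_grade a < real_of_grade b"
definition "(bot :: grade) = 0"
definition "(top :: grade) = 1"
definition "inf a b = (if a \<le> b then a else b :: grade)"
definition "sup a b = (if a \<le> b then b else a :: grade)"
definition "Sup A = (if A = {} then 0 else Grade (Sup (real_of_grade ` A)))"
definition "Inf A = (if A = {} then 1 else Grade (Inf (real_of_grade ` A)))"

lemma real_of_grade_01: "real_of_grade 0 = 0" "real_of_grade 1 = 1"
  by (simp_all add: zero_grade_def one_grade_def Grade_inverse)

lemma real_of_grade_Sup:
  assumes "A \<noteq> {}" shows "real_of_grade (Sup A) = Sup (real_of_grade ` A)"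
proof -
  obtain a where a: "a \<in> A" using assms by auto
  have "0 \<le> real_of_grade a" by (rule real_of_grade_bounds)
  also have "\<dots> \<le> Sup (real_of_grade ` A)"
    using a by (intro cSup_upper bdd_real_of_grade) auto
  finally have "0 \<le> Sup (real_of_grade ` A)" .
  moreover have "Sup (real_of_grade ` A) \<le> 1"
    using assms real_of_grade_bounds by (intro cSup_least) auto
  ultimately show ?thesis using assms by (simp add: Sup_grade_def Grade_inverse)
qed

lemma real_of_grade_Inf:
  assumes "A \<noteq> {}" shows "real_of_grade (Inf A) = Inf (real_of_grade ` A)"
proof -
  obtain a where a: "a \<in> A" using assms by auto
  have "Inf (real_of_grade ` A) \<le> real_of_grade a"
    using a by (intro cInf_lower bdd_real_of_grade) auto
  also have "\<dots> \<le> 1" by (rule real_of_grade_bounds)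
  finally have "Inf (real_of_grade ` A) \<le> 1" .
  moreover have "0 \<le> Inf (real_of_grade ` A)"
    using assms real_of_grade_bounds by (intro cInf_greatest) auto
  ultimately show ?thesis using assms by (simp add: Inf_grade_def Grade_inverse)
qed

instance
proof
  fix a b c :: grade and A :: "grade set"
  show "(0::grade) \<noteq> 1"
    using real_of_grade_01 by (metis zero_neq_one)
  show "a < b \<longleftrightarrow> a \<le> b \<and> \<not> b \<le> a"
    by (auto simp: less_eq_grade_def less_grade_def)
  show "a \<le> a" by (simp add: less_eq_grade_def)
  show "a \<le> b \<Longrightarrow> b \<le> c \<Longrightarrow> a \<le> c" by (simp add: less_eq_grade_def)
  show "a \<le> b \<Longrightarrow> b \<le> a \<Longrightarrow> a = b"
    by (simp add: less_eq_grade_def real_of_grade_inject[symmetric])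
  show "a \<le> b \<or> b \<le> a" by (auto simp: less_eq_grade_def)
  show "inf a b \<le> a" "inf a b \<le> b" "a \<le> sup a b" "b \<le> sup a b"
    by (auto simp: inf_grade_def sup_grade_def less_eq_grade_def)
  show "a \<le> b \<Longrightarrow> a \<le> c \<Longrightarrow> a \<le> inf b c"
    by (auto simp: inf_grade_def)
  show "b \<le> a \<Longrightarrow> c \<le> a \<Longrightarrow> sup b c \<le> a"
    by (auto simp: sup_grade_def)
  show "a \<in> A \<Longrightarrow> Inf A \<le> a"
    by (cases "A = {}")
      (auto simp: less_eq_grade_def real_of_grade_Inf intro!: cInf_lower bdd_real_of_grade)
  show "(\<And>x. x \<in> A \<Longrightarrow> a \<le> x) \<Longrightarrow> a \<le> Inf A"
    by (cases "A = {}")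
      (auto simp: less_eq_grade_def real_of_grade_Inf Inf_grade_def[of "{}"] real_of_grade_01
         real_of_grade_bounds intro!: cInf_greatest)
  show "a \<in> A \<Longrightarrow> a \<le> Sup A"
    by (cases "A = {}")
      (auto simp: less_eq_grade_def real_of_grade_Sup intro!: cSup_upper bdd_real_of_grade)
  show "(\<And>x. x \<in> A \<Longrightarrow> x \<le> a) \<Longrightarrow> Sup A \<le> a"
    by (cases "A = {}")
      (auto simp: less_eq_grade_def real_of_grade_Sup Sup_grade_def[of "{}"] real_of_grade_01
         real_of_grade_bounds intro!: cSup_least)
  show "Inf {} = (top :: grade)" "Sup {} = (bot :: grade)"
    by (simp_all add: Inf_grade_def Sup_grade_def top_grade_def bot_grade_def)
qed

end


section \<open>Syntax\<close>

text \<open>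
  Variables, constants and, for each arity, function and predicate symbols are numbered by
  natural numbers. In \<open>Fn j t ts\<close> and \<open>Pred j t ts\<close> the argument tuple is \<open>t # ts\<close>, and the symbol
  is the \<open>j\<close>-th one of arity \<open>Suc (length ts)\<close>. Thus arities are positive and
  every term and formula is well-formed by construction.
\<close>

datatype trm = Const nat | Var nat | Fn nat trm "trm list"

text \<open>
  \<open>Disj J F\<close> is the disjunction of the family \<open>F\<close> indexed by the set \<open>J\<close>, which may be empty or
  infinite. HOL has no type closed under disjunctions of families of every
  size, so the type \<open>'i\<close> of indices is a parameter; results stated for
  all \<open>'i\<close> cover families of any size.
\<close>

datatype 'i fm =
    Top
  | Bot
  | Pred nat trm "trm list"
  | Eq trm trm
  | And "'i fm" "'i fm"
  | Disj "'i set" "'i \<Rightarrow> 'i fm"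
  | Exists nat "'i fm"

text \<open>\<open>disj_of S \<delta>\<close>: the formula \<open>\<delta>\<close> is the disjunction of the set \<open>S\<close> of formulae, for some indexing
  of \<open>S\<close>.\<close>

definition disj_of :: "'i fm set \<Rightarrow> 'i fm \<Rightarrow> bool" where
  "disj_of S \<delta> \<longleftrightarrow> (\<exists>J F. \<delta> = Disj J F \<and> S = F ` J)"

fun tuple_eq :: "nat list \<Rightarrow> nat list \<Rightarrow> 'i fm" where
  "tuple_eq [x] [y] = Eq (Var x) (Var y)"
| "tuple_eq (x # xs) (y # ys) = And (Eq (Var x) (Var y)) (tuple_eq xs ys)"
| "tuple_eq _ _ = Top"


section \<open>Substitution\<close>

primrec fv_trm :: "trm \<Rightarrow> nat set" where
  "fv_trm (Const c) = {}"
| "fv_trm (Var x) = {x}"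
| "fv_trm (Fn j t ts) = fv_trm t \<union> \<Union> (set (map fv_trm ts))"

primrec fv :: "'i fm \<Rightarrow> nat set" where
  "fv Top = {}"
| "fv Bot = {}"
| "fv (Pred j t ts) = fv_trm t \<union> \<Union> (set (map fv_trm ts))"
| "fv (Eq t u) = fv_trm t \<union> fv_trm u"
| "fv (And \<phi> \<psi>) = fv \<phi> \<union> fv \<psi>"
| "fv (Disj J F) = (\<Union>i\<in>J. fv (F i))"
| "fv (Exists x \<phi>) = fv \<phi> - {x}"

primrec subst_trm :: "(nat \<Rightarrow> trm) \<Rightarrow> trm \<Rightarrow> trm" where
  "subst_trm \<sigma> (Const c) = Const c"
| "subst_trm \<sigma> (Var x) = \<sigma> x"
| "subst_trm \<sigma> (Fn j t ts) = Fn j (subst_trm \<sigma> t) (map (subst_trm \<sigma>) ts)"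

text \<open>Simultaneous replacement of the free occurrences of each variable \<open>x\<close> by \<open>\<sigma> x\<close>. Bound
  variables are never renamed, so a variable of \<open>\<sigma> x\<close> may be captured.\<close>

primrec subst_fm :: "(nat \<Rightarrow> trm) \<Rightarrow> 'i fm \<Rightarrow> 'i fm" where
  "subst_fm \<sigma> Top = Top"
| "subst_fm \<sigma> Bot = Bot"
| "subst_fm \<sigma> (Pred j t ts) = Pred j (subst_trm \<sigma> t) (map (subst_trm \<sigma>) ts)"
| "subst_fm \<sigma> (Eq t u) = Eq (subst_trm \<sigma> t) (subst_trm \<sigma> u)"
| "subst_fm \<sigma> (And \<phi> \<psi>) = And (subst_fm \<sigma> \<phi>) (subst_fm \<sigma> \<psi>)"
| "subst_fm \<sigma> (Disj J F) = Disj J (\<lambda>i. subst_fm \<sigma> (F i))"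
| "subst_fm \<sigma> (Exists x \<phi>) = Exists x (subst_fm (\<sigma>(x := Var x)) \<phi>)"

text \<open>The substitution of a tuple of terms for a tuple of variables, written \<open>[ts/xs]\<close> on paper.
  If \<open>xs\<close> has repetitions, the leftmost occurrence counts.\<close>

definition tuple_subst :: "trm list \<Rightarrow> nat list \<Rightarrow> nat \<Rightarrow> trm" where
  "tuple_subst ts xs z = (case map_of (zip xs ts) z of Some t \<Rightarrow> t | None \<Rightarrow> Var z)"

text \<open>
  The terms substituted by \<open>\<sigma>\<close> are free for the variables they replace: no variable of \<open>\<sigma> z\<close>
  becomes bound at a free occurrence of \<open>z\<close>. Since \<open>subst_fm\<close> does not rename,
  the rules involving substitution are sound only under this proviso; for
  example \<open>x = y \<and> (\<exists>y. p(x,y))\<close> does not entail \<open>\<exists>y. p(y,y)\<close>.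
\<close>

primrec free_for :: "(nat \<Rightarrow> trm) \<Rightarrow> 'i fm \<Rightarrow> bool" where
  "free_for \<sigma> Top \<longleftrightarrow> True"
| "free_for \<sigma> Bot \<longleftrightarrow> True"
| "free_for \<sigma> (Pred j t ts) \<longleftrightarrow> True"
| "free_for \<sigma> (Eq t u) \<longleftrightarrow> True"
| "free_for \<sigma> (And \<phi> \<psi>) \<longleftrightarrow> free_for \<sigma> \<phi> \<and> free_for \<sigma> \<psi>"
| "free_for \<sigma> (Disj J F) \<longleftrightarrow> (\<forall>i\<in>J. free_for \<sigma> (F i))"
| "free_for \<sigma> (Exists x \<phi>) \<longleftrightarrow>
     free_for (\<sigma>(x := Var x)) \<phi> \<and> (\<forall>z \<in> fv \<phi> - {x}. x \<notin> fv_trm (\<sigma> z))"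

lemma subst_trm_Var: "subst_trm Var t = t"
  by (induction t) (auto intro: map_idI)

lemma subst_fm_Var: "subst_fm Var \<phi> = \<phi>"
proof (induction \<phi>)
  case (Pred j t ts)
  show ?case by (auto simp: subst_trm_Var intro: map_idI)
qed (simp_all add: subst_trm_Var fun_upd_idem)

lemma tuple_subst_single: "tuple_subst [t] [x] = Var(x := t)"
  by (auto simp: tuple_subst_def fun_eq_iff)

lemma subst_fm_Exists_other:
  assumes "z \<noteq> x"
  shows "subst_fm (tuple_subst [t] [x]) (Exists z \<psi>) = Exists z (subst_fm (tuple_subst [t] [x]) \<psi>)"
  using assms by (simp add: tuple_subst_single fun_upd_twist[of z x] fun_upd_idem)

lemma subst_fm_Exists_same: "subst_fm (tuple_subst [t] [x]) (Exists x \<psi>) = Exists x \<psi>"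
  by (simp add: tuple_subst_single fun_upd_idem subst_fm_Var)


section \<open>Semantics\<close>

text \<open>\<open>fn I i j\<close> and \<open>prd I i j\<close> interpret the \<open>j\<close>-th symbols of arity \<open>i\<close>; only their values on
  lists of length \<open>i\<close> over the domain matter.\<close>

record 'd interp =
  carrier :: "'d set"
  cst :: "nat \<Rightarrow> 'd"
  fn :: "nat \<Rightarrow> nat \<Rightarrow> 'd list \<Rightarrow> 'd"
  prd :: "nat \<Rightarrow> nat \<Rightarrow> 'd list \<Rightarrow> grade"

definition is_interp :: "'d interp \<Rightarrow> bool" where
  "is_interp I \<longleftrightarrow>
     (\<forall>c. cst I c \<in> carrier I) \<and>
     (\<forall>i>0. \<forall>j. \<forall>ds. length ds = i \<and> set ds \<subseteq> carrier I \<longrightarrow> fn I i j ds \<in> carrier I)"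

primrec val :: "'d interp \<Rightarrow> (nat \<Rightarrow> 'd) \<Rightarrow> trm \<Rightarrow> 'd" where
  "val I s (Const c) = cst I c"
| "val I s (Var x) = s x"
| "val I s (Fn j t ts) = fn I (Suc (length ts)) j (val I s t # map (val I s) ts)"

primrec gr :: "'d interp \<Rightarrow> (nat \<Rightarrow> 'd) \<Rightarrow> 'i fm \<Rightarrow> grade" where
  "gr I s Top = 1"
| "gr I s Bot = 0"
| "gr I s (Pred j t ts) = prd I (Suc (length ts)) j (val I s t # map (val I s) ts)"
| "gr I s (Eq t u) = (if val I s t = val I s u then 1 else 0)"
| "gr I s (And \<phi> \<psi>) = min (gr I s \<phi>) (gr I s \<psi>)"
| "gr I s (Disj J F) = (SUP i\<in>J. gr I s (F i))"
| "gr I s (Exists x \<phi>) = (SUP d\<in>carrier I. gr I (s(x := d)) \<phi>)"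

definition valid :: "'d interp \<Rightarrow> 'i fm \<Rightarrow> 'i fm \<Rightarrow> bool" where
  "valid I \<phi> \<psi> \<longleftrightarrow> (\<forall>s. range s \<subseteq> carrier I \<longrightarrow> gr I s \<phi> \<le> gr I s \<psi>)"

end

theory Submission imports Defs begin

text \<open>
  The rules that do not touch variables express that the grades form a complete chain with
  \<open>min\<close> as meet: a sequent says that one grade is at most another for every assignment, conjunction is a
  meet and disjunction is a supremum. The rules for disjunctions under conjunction and for
  existential quantifiers under conjunction are the two instances of the infinite distributive law
  \<open>min a (SUP b) = SUP (min a b)\<close>, which holds in every complete chain; in the second one,
  \<open>gr_cong\<close> makes the grade of \<open>\<phi>\<close> constant while the value of the bound variable \<open>y\<close> varies over the domain.

  The rules with substitution rest on the substitution lemma \<open>gr_subst_fm\<close>: if no variable is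
  captured, replacing variables by terms in a formula has the same effect on its grade as
  replacing their values in the assignment. For \<open>\<psi>[x/y]\<close> the new assignment is \<open>s(y := s x)\<close>, so
  \<open>\<psi>[x/y]\<close> is graded by one of the values whose supremum grades \<open>\<exists>y. \<psi>\<close>. For the
  substitution of equals, identity is a crisp predicate: the grade of the hypothesis
  \<open>(x\<^sub>1,\<dots>,x\<^sub>n) = (y\<^sub>1,\<dots>,y\<^sub>n)\<close> is either 0, and there is nothing to prove, or 1, and then the new
  assignment is the old one.
\<close>

section \<open>Grades as a complete chain\<close>

lemma grade_le_1 [simp]: "(a :: grade) \<le> 1"
  using top_greatest[of a] by (simp add: top_grade_def)

lemma grade_ge_0 [simp]: "(0 :: grade) \<le> a"
  using bot_least[of a] by (simp add: bot_grade_def)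

lemma min_1_grade [simp]: "min 1 a = (a :: grade)"
  by (simp add: min_absorb2)

lemma min_0_grade [simp]: "min 0 a = (0 :: grade)"
  by (simp add: min_absorb1)

text \<open>The constant \<open>inf\<close> of the complete lattice of grades has its own definition by cases,
  whereas the grade of a conjunction uses the generic \<open>min\<close> of linear orders; in a chain they coincide,
  and \<open>min\<close> inherits the frame law.\<close>

lemma min_SUP_grade:
  fixes a :: grade
  shows "min a (SUP i\<in>J. f i) = (SUP i\<in>J. min a (f i))"
  using inf_SUP[of a f J] by (simp add: inf_min)

section \<open>Assignments and substitutions\<close>

lemma val_cong: "(\<And>z. z \<in> fv_trm t \<Longrightarrow> s z = s' z) \<Longrightarrow> val I s t = val I s' t"
proof (induction t)
  case (Fn j t ts)
  then have "\<forall>u\<in>set (t # ts). val I s u = val I s' u" by auto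
  then show ?case by (simp cong: map_cong)
qed auto

lemma gr_cong: "(\<And>z. z \<in> fv \<phi> \<Longrightarrow> s z = s' z) \<Longrightarrow> gr I s \<phi> = gr I s' \<phi>"
proof (induction \<phi> arbitrary: s s')
  case (Pred j t ts)
  then have "\<forall>u\<in>set (t # ts). val I s u = val I s' u"
    by (intro ballI val_cong) auto
  then show ?case by (simp cong: map_cong)
next
  case (Eq t u)
  have "val I s t = val I s' t" "val I s u = val I s' u"
    using Eq by (auto intro!: val_cong)
  then show ?case by simp
next
  case (And \<phi> \<psi>)
  have "gr I s \<phi> = gr I s' \<phi>" "gr I s \<psi> = gr I s' \<psi>"
    using And.prems by (auto intro!: And.IH)
  then show ?case by simp
next
  case (Disj J F)
  have "gr I s (F i) = gr I s' (F i)" if "i \<in> J" for i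
    using that Disj.prems by (intro Disj.IH) auto
  then show ?case by simp
next
  case (Exists x \<phi>)
  have "gr I (s(x := d)) \<phi> = gr I (s'(x := d)) \<phi>" for d
    using Exists.prems by (intro Exists.IH) auto
  then show ?case by simp
qed auto

lemma val_subst_trm: "val I s (subst_trm \<sigma> t) = val I (\<lambda>z. val I s (\<sigma> z)) t"
  by (induction t) (simp_all cong: map_cong)

text \<open>The quantifier is the only case with content. There the two sides of the induction step
  use the assignments obtained by first updating \<open>x\<close> and then substituting, or first substituting and then
  updating \<open>x\<close>. They differ at a variable \<open>z\<close> only if \<open>z \<noteq> x\<close> and \<open>x\<close> occurs in \<open>\<sigma> z\<close>, and
  \<open>free_for\<close> says that no such \<open>z\<close> is free in the body.\<close>

lemma gr_subst_fm:
  "free_for \<sigma> \<phi> \<Longrightarrow> gr I s (subst_fm \<sigma> \<phi>) = gr I (\<lambda>z. val I s (\<sigma> z)) \<phi>"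
proof (induction \<phi> arbitrary: \<sigma> s)
  case (Exists x \<phi>)
  have "gr I (s(x := d)) (subst_fm (\<sigma>(x := Var x)) \<phi>)
      = gr I ((\<lambda>z. val I s (\<sigma> z))(x := d)) \<phi>" for d
  proof -
    have "gr I (s(x := d)) (subst_fm (\<sigma>(x := Var x)) \<phi>)
        = gr I (\<lambda>z. val I (s(x := d)) ((\<sigma>(x := Var x)) z)) \<phi>"
      using Exists.prems by (intro Exists.IH[of "\<sigma>(x := Var x)"]) (simp only: free_for.simps)
    also have "\<dots> = gr I ((\<lambda>z. val I s (\<sigma> z))(x := d)) \<phi>"
    proof (rule gr_cong)
      fix z assume z: "z \<in> fv \<phi>"
      show "val I (s(x := d)) ((\<sigma>(x := Var x)) z) = ((\<lambda>z. val I s (\<sigma> z))(x := d)) z"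
      proof (cases "z = x")
        case False
        with z Exists.prems have "x \<notin> fv_trm (\<sigma> z)" by simp
        then have "val I (s(x := d)) (\<sigma> z) = val I s (\<sigma> z)"
          by (intro val_cong) auto
        with False show ?thesis by simp
      qed simp
    qed
    finally show ?thesis .
  qed
  then show ?case by simp
qed (simp_all add: val_subst_trm cong: map_cong)

lemma gr_subst_fm_single:
  assumes "free_for (tuple_subst [Var x] [y]) \<phi>"
  shows "gr I s (subst_fm (tuple_subst [Var x] [y]) \<phi>) = gr I (s(y := s x)) \<phi>"
proof -
  have "(\<lambda>z. val I s (tuple_subst [Var x] [y] z)) = s(y := s x)"
    by (auto simp: tuple_subst_single)
  then show ?thesis by (simp only: gr_subst_fm[OF assms])
qed

lemma gr_tuple_eq:
  "length xs = length ys \<Longrightarrow>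
    gr I s (tuple_eq xs ys) = (if map s xs = map s ys then 1 else 0)"
  by (induction xs ys rule: tuple_eq.induct) auto

text \<open>Once the equations hold, every occurrence of \<open>z\<close> in \<open>xs\<close> is paired with a variable of the same
  value \<open>s z\<close>, so repetitions in \<open>xs\<close> do no harm.\<close>

lemma val_tuple_subst_Var:
  assumes "map s xs = map s ys"
  shows "val I s (tuple_subst (map Var ys) xs z) = s z"
proof (cases "map_of (zip xs (map Var ys)) z")
  case (Some t)
  then have "(z, t) \<in> set (zip xs (map Var ys))"
    by (rule map_of_SomeD)
  then obtain i where "i < length xs" "i < length ys" "z = xs ! i" "t = Var (ys ! i)"
    by (auto simp: in_set_zip)
  moreover from this assms have "s (xs ! i) = s (ys ! i)"
    by (metis nth_map)
  ultimately show ?thesis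
    using Some by (simp add: tuple_subst_def)
qed (simp add: tuple_subst_def)

section \<open>Soundness of the rules\<close>

lemma valid_Disj_upper: "disj_of S \<delta> \<Longrightarrow> \<phi> \<in> S \<Longrightarrow> valid I \<phi> \<delta>"
  by (auto simp: disj_of_def valid_def intro: SUP_upper)

lemma valid_Disj_least: "disj_of S \<delta> \<Longrightarrow> (\<And>\<phi>. \<phi> \<in> S \<Longrightarrow> valid I \<phi> \<psi>) \<Longrightarrow> valid I \<delta> \<psi>"
  by (auto simp: disj_of_def valid_def intro!: SUP_least)

text \<open>The two disjunctions may be indexed in unrelated ways, but the grade of a disjunction depends only
  on its set of disjuncts.\<close>

lemma gr_disj_of: "disj_of S \<delta> \<Longrightarrow> gr I s \<delta> = (SUP \<phi>\<in>S. gr I s \<phi>)"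
  by (auto simp: disj_of_def image_image)

lemma valid_And_Disj:
  assumes "disj_of S \<delta>" and "disj_of {And \<phi> \<psi> | \<psi>. \<psi> \<in> S} \<epsilon>"
  shows "valid I (And \<phi> \<delta>) \<epsilon>"
proof -
  have "{And \<phi> \<psi> | \<psi>. \<psi> \<in> S} = And \<phi> ` S" by auto
  with assms(2) have "gr I s \<epsilon> = (SUP \<psi>\<in>S. min (gr I s \<phi>) (gr I s \<psi>))" for s
    by (simp add: gr_disj_of image_image)
  with assms(1) show ?thesis
    by (simp add: valid_def gr_disj_of min_SUP_grade)
qed

lemma valid_subst_equals:
  assumes "length xs = length ys" and "free_for (tuple_subst (map Var ys) xs) \<phi>"
  shows "valid I (And (tuple_eq xs ys) \<phi>) (subst_fm (tuple_subst (map Var ys) xs) \<phi>)"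
  using assms by (simp add: valid_def gr_tuple_eq gr_subst_fm val_tuple_subst_Var)

text \<open>The assignment maps \<open>x\<close> into the domain, so \<open>s x\<close> is one of the witnesses over which the
  supremum for \<open>\<exists>y\<close> is taken. Both quantifier rules follow by transitivity.\<close>

lemma valid_subst_Exists:
  assumes "free_for (tuple_subst [Var x] [y]) \<phi>"
  shows "valid I (subst_fm (tuple_subst [Var x] [y]) \<phi>) (Exists y \<phi>)"
  using assms by (auto simp: valid_def gr_subst_fm_single intro!: SUP_upper)

lemma valid_And_Exists:
  assumes "y \<notin> fv \<phi>"
  shows "valid I (And \<phi> (Exists y \<psi>)) (Exists y (And \<phi> \<psi>))"
proof -
  have "gr I (s(y := d)) \<phi> = gr I s \<phi>" for s d
    using assms by (intro gr_cong) auto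
  then show ?thesis
    by (simp add: valid_def min_SUP_grade)
qed

lemma valid_trans: "valid I \<phi> \<psi> \<Longrightarrow> valid I \<psi> \<chi> \<Longrightarrow> valid I \<phi> \<chi>"
  by (auto simp: valid_def intro: order_trans)

theorem theorem6p2p4:
  fixes I :: "'d interp"
    and \<phi> \<psi> \<chi> \<delta> \<epsilon> :: "'i fm"
    and S :: "'i fm set"
    and x y :: nat
    and xs ys :: "nat list"
  assumes "is_interp I"
  shows
    "valid I \<phi> \<phi> \<and>
     (valid I \<phi> \<psi> \<and> valid I \<psi> \<chi> \<longrightarrow> valid I \<phi> \<chi>) \<and>
     valid I \<phi> Top \<and>
     valid I (And \<phi> \<psi>) \<phi> \<and>
     valid I (And \<phi> \<psi>) \<psi> \<and>
     (valid I \<phi> \<psi> \<and> valid I \<phi> \<chi> \<longrightarrow> valid I \<phi> (And \<psi> \<chi>)) \<and>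
     (disj_of S \<delta> \<and> \<phi> \<in> S \<longrightarrow> valid I \<phi> \<delta>) \<and>
     (disj_of S \<delta> \<and> (\<forall>\<phi>\<in>S. valid I \<phi> \<psi>) \<longrightarrow> valid I \<delta> \<psi>) \<and>
     (disj_of S \<delta> \<and> disj_of {And \<phi> \<psi> | \<psi>. \<psi> \<in> S} \<epsilon> \<longrightarrow> valid I (And \<phi> \<delta>) \<epsilon>) \<and>
     valid I (Top :: 'i fm) (Eq (Var x) (Var x)) \<and>
     (length xs = length ys \<and> free_for (tuple_subst (map Var ys) xs) \<phi> \<longrightarrow>
        valid I (And (tuple_eq xs ys) \<phi>) (subst_fm (tuple_subst (map Var ys) xs) \<phi>)) \<and>
     (free_for (tuple_subst [Var x] [y]) \<psi> \<and>
        valid I \<phi> (subst_fm (tuple_subst [Var x] [y]) \<psi>) \<longrightarrow> valid I \<phi> (Exists y \<psi>)) \<and>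
     (free_for (tuple_subst [Var x] [y]) \<phi> \<and>
        valid I (Exists y \<phi>) \<psi> \<longrightarrow> valid I (subst_fm (tuple_subst [Var x] [y]) \<phi>) \<psi>) \<and>
     (y \<notin> fv \<phi> \<longrightarrow> valid I (And \<phi> (Exists y \<psi>)) (Exists y (And \<phi> \<psi>)))"
proof (intro conjI impI)
  show "valid I \<phi> \<phi>" "valid I \<phi> Top"
    "valid I (And \<phi> \<psi>) \<phi>" "valid I (And \<phi> \<psi>) \<psi>"
    "valid I (Top :: 'i fm) (Eq (Var x) (Var x))"
    by (simp_all add: valid_def)
  show "valid I \<phi> (And \<psi> \<chi>)" if "valid I \<phi> \<psi> \<and> valid I \<phi> \<chi>"
    using that by (simp add: valid_def)
qed (auto intro: valid_trans valid_Disj_upper valid_Disj_least valid_And_Disj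
      valid_subst_equals valid_subst_Exists valid_And_Exists)

end
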